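(* Let $a_X,\theta_X,a_Y,\theta_Y>0$ and let $X$ and $Y$ be independent random variables having Pareto distributions with parameters $a_X,\theta_X$ and $a_Y,\theta_Y$, respectively. Let $Z=XY$. If $a_X\neq a_Y$, then $Z$ has the probability density function $$f_Z(z)=a_Xa_Y\left(\frac{z^{-a_X-1}(\theta_X\theta_Y)^{a_X}}{a_Y-a_X}+\frac{z^{-a_Y-1}(\theta_X\theta_Y)^{a_Y}}{a_X-a_Y}\right),\qquad z>\theta_X\theta_Y.$$ If $a_X=a_Y=a$, then $Z$ has the probability density function $$f_Z(z)=a^2(\theta_X\theta_Y)^{a}z^{-a-1}\log\left(\frac{z}{\theta_X\theta_Y}\right),\qquad z>\theta_X\theta_Y.$$
   Context: A real random variable has the Pareto distribution with parameters $a,\theta>0$ if it has the probability density function (with respect to Lebesgue measure) $f(x)=a\theta^{a}/x^{a+1}$ for $x>\theta$, and $f(x)=0$ otherwise. A density whose formula is given only on an indicated range is zero outside that range. $\log$ is the natural logarithm. *)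

theory Defs
  imports "HOL-Probability.Probability"
begin

(* The constant distributed takes densities in ennreal, and ennreal maps negative reals to 0.
   Nonnegativity is therefore required explicitly, so that f itself is the density. *)
definition has_pdf :: "'a measure \<Rightarrow> ('a \<Rightarrow> real) \<Rightarrow> (real \<Rightarrow> real) \<Rightarrow> bool" where
  "has_pdf M X f \<longleftrightarrow>
     (\<forall>x. 0 \<le> f x) \<and> distributed M lborel X (\<lambda>x. ennreal (f x))"

definition pareto_density :: "real \<Rightarrow> real \<Rightarrow> real \<Rightarrow> real" where
  "pareto_density a \<theta> x = (if x > \<theta> then a * \<theta> powr a / x powr (a + 1) else 0)"

end

theory Submission
  imports Defs
begin

text \<open>
  For independent \<open>X\<close> and \<open>Y\<close> with densities \<open>f\<close> and \<open>g\<close>, the substitution \<open>x = z / y\<close> for fixed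
  \<open>y \<noteq> 0\<close> and Tonelli's theorem show that \<open>X Y\<close> has the density \<open>z \<mapsto> \<integral> f (z / y) g y / \<bar>y\<bar> dy\<close>. For
  Pareto densities the integrand is supported on \<open>\<theta>\<^sub>Y < y < z / \<theta>\<^sub>X\<close>, where it is a constant times
  \<open>y\<close> to the power \<open>a\<^sub>X - a\<^sub>Y - 1\<close>; the antiderivative is a power of \<open>y\<close> if
  \<open>a\<^sub>X \<noteq> a\<^sub>Y\<close>, and a logarithm if \<open>a\<^sub>X = a\<^sub>Y\<close>.
\<close>

text \<open>The Jacobian factor stays inside the integral, where it joins the integrand of the
  product density; its absolute value covers negative \<open>y\<close>, for which the substitution
  reverses orientation.\<close>

lemma nn_integral_lborel_scale:
  fixes h :: "real \<Rightarrow> ennreal" and y :: real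
  assumes [measurable]: "h \<in> borel_measurable borel" and "y \<noteq> 0"
  shows "(\<integral>\<^sup>+x. h x \<partial>lborel) = (\<integral>\<^sup>+z. h (z / y) * ennreal (1 / \<bar>y\<bar>) \<partial>lborel)"
proof -
  have "(\<integral>\<^sup>+x. h x \<partial>lborel) = ennreal \<bar>1 / y\<bar> * (\<integral>\<^sup>+z. h (0 + 1 / y * z) \<partial>lborel)"
    using assms by (intro nn_integral_real_affine) auto
  also have "\<dots> = (\<integral>\<^sup>+z. h (z / y) * ennreal (1 / \<bar>y\<bar>) \<partial>lborel)"
    by (simp add: nn_integral_multc mult.commute)
  finally show ?thesis .
qed

text \<open>The law of the product is tested on a Borel set \<open>A\<close>: its probability is the
  integral of the indicator of \<open>x * y \<in> A\<close> against the joint density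
  \<open>f x * g y\<close>. Working in \<open>ennreal\<close> makes Tonelli applicable without
  integrability conditions.\<close>

lemma (in prob_space) distributed_mult:
  fixes f g :: "real \<Rightarrow> ennreal" and X Y :: "'a \<Rightarrow> real"
  assumes indep: "indep_var borel X borel Y"
    and X: "distributed M lborel X f" and Y: "distributed M lborel Y g"
  shows "distributed M lborel (\<lambda>\<omega>. X \<omega> * Y \<omega>)
    (\<lambda>z. \<integral>\<^sup>+y. f (z / y) * g y * ennreal (1 / \<bar>y\<bar>) \<partial>lborel)"
    (is "distributed M lborel ?Z ?h")
  unfolding distributed_def
proof safe
  have [measurable]: "f \<in> borel_measurable borel" "g \<in> borel_measurable borel"
    using distributed_borel_measurable[OF X] distributed_borel_measurable[OF Y] by simp_all
  have [measurable]: "X \<in> borel_measurable M" "Y \<in> borel_measurable M"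
    using distributed_measurable[OF X] distributed_measurable[OF Y] by simp_all
  show h[measurable]: "?h \<in> borel_measurable lborel"
    by measurable
  show "?Z \<in> measurable M lborel"
    by simp
  \<comment> \<open>Composing with \<open>id\<close> only changes the target measure from
    \<open>borel\<close> to \<open>lborel\<close>, which has the same measurable sets; the joint
    density rule wants independence over the reference measures.\<close>
  have "indep_var lborel (id \<circ> X) lborel (id \<circ> Y)"
    by (rule indep_var_compose[OF indep]) simp_all
  then have J: "distributed M (lborel \<Otimes>\<^sub>M lborel) (\<lambda>\<omega>. (X \<omega>, Y \<omega>)) (\<lambda>(x, y). f x * g y)"
    using X Y by (intro distributed_joint_indep) (simp_all add: lborel.sigma_finite_measure_axioms)
  show "distr M lborel ?Z = density lborel ?h"
  proof (rule measure_eqI)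
    fix A assume "A \<in> sets (distr M lborel ?Z)"
    then have A[measurable]: "A \<in> sets borel" by simp
    have "emeasure (distr M lborel ?Z) A = (\<integral>\<^sup>+z. indicator A z \<partial>distr M lborel ?Z)"
      by simp
    also have "\<dots> = (\<integral>\<^sup>+\<omega>. indicator A (?Z \<omega>) \<partial>M)"
      by (rule nn_integral_distr) simp_all
    also have "\<dots> = (\<integral>\<^sup>+p. (case p of (x, y) \<Rightarrow> f x * g y) *
        (case p of (x, y) \<Rightarrow> indicator A (x * y)) \<partial>(lborel \<Otimes>\<^sub>M lborel))"
      by (subst distributed_nn_integral[OF J]) simp_all
    \<comment> \<open>The integral over \<open>x\<close> is made the inner one, so that
      \<open>y\<close> is fixed when \<open>x = z / y\<close> is substituted.\<close>
    also have "\<dots> = (\<integral>\<^sup>+y. \<integral>\<^sup>+x. f x * g y * indicator A (x * y) \<partial>lborel \<partial>lborel)"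
      by (subst lborel_pair.nn_integral_snd[symmetric]) simp_all
    also have "\<dots> = (\<integral>\<^sup>+y. \<integral>\<^sup>+z. f (z / y) * g y * ennreal (1 / \<bar>y\<bar>) * indicator A z
        \<partial>lborel \<partial>lborel)"
    proof (rule nn_integral_cong_AE)
      show "AE y in lborel. (\<integral>\<^sup>+x. f x * g y * indicator A (x * y) \<partial>lborel) =
          (\<integral>\<^sup>+z. f (z / y) * g y * ennreal (1 / \<bar>y\<bar>) * indicator A z \<partial>lborel)"
        \<comment> \<open>The substitution divides by \<open>y\<close>; the exceptional point
          \<open>y = 0\<close> is a null set.\<close>
        using AE_lborel_singleton[of "0::real"]
      proof eventually_elim
        fix y :: real assume "y \<noteq> 0"
        then show "(\<integral>\<^sup>+x. f x * g y * indicator A (x * y) \<partial>lborel) =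
            (\<integral>\<^sup>+z. f (z / y) * g y * ennreal (1 / \<bar>y\<bar>) * indicator A z \<partial>lborel)"
          by (subst nn_integral_lborel_scale[where y = y]) (simp_all add: mult_ac)
      qed
    qed
    also have "\<dots> = (\<integral>\<^sup>+z. \<integral>\<^sup>+y. f (z / y) * g y * ennreal (1 / \<bar>y\<bar>) * indicator A z
        \<partial>lborel \<partial>lborel)"
      \<comment> \<open>With \<open>z\<close> outermost, \<open>indicator A z\<close> is constant in
        the inner integral and can be pulled out, leaving \<open>?h z\<close>.\<close>
      by (rule lborel_pair.Fubini') measurable
    also have "\<dots> = (\<integral>\<^sup>+z. ?h z * indicator A z \<partial>lborel)"
      by (simp add: nn_integral_multc)
    also have "\<dots> = emeasure (density lborel ?h) A"
      by (subst emeasure_density) simp_all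
    finally show "emeasure (distr M lborel ?Z) A = emeasure (density lborel ?h) A" .
  qed simp
qed

text \<open>Between the endpoints, the factors contribute \<open>y\<close> to the powers
  \<open>a + 1\<close>, \<open>- (b + 1)\<close> and \<open>- 1\<close>, which add up to
  \<open>a - b - 1\<close>. The densities are cut off by strict inequalities while the indicator is
  that of a closed interval, hence the exclusion of both endpoints.\<close>

lemma pareto_mult_integrand:
  fixes a b \<theta> \<eta> y z :: real
  assumes "0 < \<theta>" "0 < \<eta>" "0 < z" "y \<noteq> \<eta>" "y \<noteq> z / \<theta>"
  shows "pareto_density a \<theta> (z / y) * pareto_density b \<eta> y * (1 / \<bar>y\<bar>) =
    a * b * \<theta> powr a * \<eta> powr b * z powr (- a - 1) * y powr (a - b - 1) *
      indicator {\<eta>..z / \<theta>} y"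
proof (cases "\<eta> < y \<and> y < z / \<theta>")
  case True
  then have "0 < y" "\<theta> < z / y"
    using assms by (auto simp: field_simps)
  moreover have "(z / y) powr (a + 1) = z powr (a + 1) / y powr (a + 1)"
    using \<open>0 < y\<close> \<open>0 < z\<close> by (simp add: powr_divide)
  moreover have "z powr (- a - 1) = 1 / z powr (a + 1)"
    using powr_minus_divide[of z "a + 1"] by simp
  moreover have "y powr (a - b - 1) = y powr (a + 1) / (y powr (b + 1) * y)"
  proof -
    have "y powr (b + 1) * y = y powr (b + 2)"
      using \<open>0 < y\<close> powr_add[of y "b + 1" 1] by (simp add: add.assoc)
    then show ?thesis
      using powr_diff[of y "a + 1" "b + 2"] by (simp add: algebra_simps)
  qed
  ultimately show ?thesis
    using True by (simp add: pareto_density_def mult_ac)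
next
  case False
  \<comment> \<open>Once \<open>\<eta> < y\<close>, \<open>y\<close> is positive, so
    \<open>\<theta> < z / y\<close> means \<open>y < z / \<theta>\<close>. Outside the interval at
    least one of the two densities therefore vanishes.\<close>
  then have "\<not> (\<eta> < y \<and> \<theta> < z / y)"
    using assms by (auto simp: field_simps)
  moreover have "y \<notin> {\<eta>..z / \<theta>}"
    using False assms by auto
  ultimately show ?thesis
    by (auto simp: pareto_density_def)
qed

text \<open>This reduces equal and unequal shape parameters alike to one integral over a compact
  interval: any closed form \<open>I\<close> of that integral gives the density.\<close>

lemma has_pdf_mult_paretoI:
  fixes X Y :: "'a \<Rightarrow> real" and I :: "real \<Rightarrow> real" and a b \<theta> \<eta> :: real
  assumes "prob_space M" and pos: "0 < a" "0 < \<theta>" "0 < b" "0 < \<eta>"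
    and X: "has_pdf M X (pareto_density a \<theta>)" and Y: "has_pdf M Y (pareto_density b \<eta>)"
    and indep: "prob_space.indep_var M borel X borel Y"
    and [measurable]: "I \<in> borel_measurable borel"
    and I: "\<And>z. \<theta> * \<eta> < z \<Longrightarrow>
      ((\<lambda>y. a * b * \<theta> powr a * \<eta> powr b * z powr (- a - 1) * y powr (a - b - 1))
        has_integral I z) {\<eta>..z / \<theta>}"
  shows "has_pdf M (\<lambda>\<omega>. X \<omega> * Y \<omega>) (\<lambda>z. if \<theta> * \<eta> < z then I z else 0)"
proof -
  interpret prob_space M by fact
  let ?k = "\<lambda>z y. a * b * \<theta> powr a * \<eta> powr b * z powr (- a - 1) * y powr (a - b - 1)"
  let ?h = "\<lambda>z y. ennreal (pareto_density a \<theta> (z / y)) * ennreal (pareto_density b \<eta> y) *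
    ennreal (1 / \<bar>y\<bar>)"
  have k_nonneg: "0 \<le> ?k z y" for z y
    using pos by simp
  \<comment> \<open>Nonnegativity is inherited from the integrand, which avoids a sign analysis of
    closed forms whose terms have opposite signs.\<close>
  have I_nonneg: "0 \<le> I z" if "\<theta> * \<eta> < z" for z
    using I[OF that] k_nonneg by (rule has_integral_nonneg)
  have nonneg: "0 \<le> pareto_density a \<theta> x" "0 \<le> pareto_density b \<eta> x" for x
    using X Y by (auto simp: has_pdf_def)
  have h_integral: "(\<integral>\<^sup>+y. ?h z y \<partial>lborel) = ennreal (if \<theta> * \<eta> < z then I z else 0)" for z
  proof (cases "\<theta> * \<eta> < z")
    case True
    then have "0 < z"
      using pos by (smt (verit) mult_pos_pos)
    have "(\<integral>\<^sup>+y. ?h z y \<partial>lborel) = (\<integral>\<^sup>+y. ennreal (?k z y) * indicator {\<eta>..z / \<theta>} y \<partial>lborel)"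
    proof (rule nn_integral_cong_AE)
      show "AE y in lborel. ?h z y = ennreal (?k z y) * indicator {\<eta>..z / \<theta>} y"
        using AE_lborel_singleton[of \<eta>] AE_lborel_singleton[of "z / \<theta>"]
      proof eventually_elim
        fix y :: real assume y: "y \<noteq> \<eta>" "y \<noteq> z / \<theta>"
        have "?h z y = ennreal (pareto_density a \<theta> (z / y) * pareto_density b \<eta> y * (1 / \<bar>y\<bar>))"
          by (simp add: nonneg flip: ennreal_mult)
        also have "\<dots> = ennreal (?k z y * indicator {\<eta>..z / \<theta>} y)"
          using pareto_mult_integrand[OF pos(2,4) \<open>0 < z\<close> y] by simp
        also have "\<dots> = ennreal (?k z y) * indicator {\<eta>..z / \<theta>} y"
          by (simp split: split_indicator)
        finally show "?h z y = ennreal (?k z y) * indicator {\<eta>..z / \<theta>} y" .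
      qed
    qed
    \<comment> \<open>The gauge integral of a nonnegative function agrees with its Lebesgue
      integral.\<close>
    also have "\<dots> = ennreal (I z)"
      using k_nonneg I[OF True] by (rule nn_integral_has_integral_lebesgue')
    finally show ?thesis
      using True by simp
  next
    case False
    \<comment> \<open>If \<open>z \<le> \<theta> * \<eta>\<close> and \<open>\<eta> < y\<close>,
      then \<open>z < \<theta> * y\<close>, so \<open>z / y\<close> lies below the support of the
      first density; if \<open>y \<le> \<eta>\<close>, the second density vanishes.\<close>
    have h_zero: "?h z y = 0" for y
    proof (cases "\<eta> < y")
      case True
      then have "z \<le> \<theta> * y"
        using False pos by (smt (verit) mult_strict_left_mono)
      then have "\<not> \<theta> < z / y"
        using True pos by (simp add: field_simps)
      then show ?thesis
        by (simp add: pareto_density_def)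
    qed (simp add: pareto_density_def)
    show ?thesis
      unfolding h_zero using False by simp
  qed
  have "distributed M lborel (\<lambda>\<omega>. X \<omega> * Y \<omega>) (\<lambda>z. \<integral>\<^sup>+y. ?h z y \<partial>lborel)"
    using X Y by (intro distributed_mult[OF indep]) (simp_all add: has_pdf_def)
  then show ?thesis
    using I_nonneg by (simp add: has_pdf_def h_integral)
qed

lemma has_integral_powr_diff_neq:
  fixes c r s t :: real
  assumes "r \<noteq> 0" "0 < s" "s \<le> t"
  shows "((\<lambda>y. c * y powr (r - 1)) has_integral c * (t powr r - s powr r) / r) {s..t}"
proof -
  have "((\<lambda>y. c * y powr (r - 1)) has_integral c * t powr r / r - c * s powr r / r) {s..t}"
    using assms
    by (intro fundamental_theorem_of_calculus)
       (auto intro!: derivative_eq_intros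
         simp flip: has_real_derivative_iff_has_vector_derivative)
  then show ?thesis
    by (simp add: diff_divide_distrib right_diff_distrib)
qed

text \<open>This is the exponent \<open>r - 1\<close> at \<open>r = 0\<close>, where the
  antiderivative \<open>c * y powr r / r\<close> breaks down and \<open>c * ln y\<close> replaces
  it.\<close>

lemma has_integral_powr_minus_one:
  fixes c s t :: real
  assumes "0 < s" "s \<le> t"
  shows "((\<lambda>y. c * y powr - 1) has_integral c * ln (t / s)) {s..t}"
proof -
  have "((\<lambda>y. c * y powr - 1) has_integral c * ln t - c * ln s) {s..t}"
    using assms
    by (intro fundamental_theorem_of_calculus)
       (auto intro!: derivative_eq_intros simp: powr_minus_divide
         simp flip: has_real_derivative_iff_has_vector_derivative)
  then show ?thesis
    using assms by (simp add: ln_div right_diff_distrib)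
qed

theorem lemma1:
  fixes M :: "'a measure" and X Y Z :: "'a \<Rightarrow> real"
    and a\<^sub>X \<theta>\<^sub>X a\<^sub>Y \<theta>\<^sub>Y :: real
  assumes "prob_space M"
    and "a\<^sub>X > 0" and "\<theta>\<^sub>X > 0" and "a\<^sub>Y > 0" and "\<theta>\<^sub>Y > 0"
    and "has_pdf M X (pareto_density a\<^sub>X \<theta>\<^sub>X)"
    and "has_pdf M Y (pareto_density a\<^sub>Y \<theta>\<^sub>Y)"
    and "prob_space.indep_var M borel X borel Y"
    and "Z = (\<lambda>\<omega>. X \<omega> * Y \<omega>)"
  shows "(a\<^sub>X \<noteq> a\<^sub>Y \<longrightarrow>
           has_pdf M Z (\<lambda>z. if z > \<theta>\<^sub>X * \<theta>\<^sub>Y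
             then a\<^sub>X * a\<^sub>Y *
               (z powr (- a\<^sub>X - 1) * (\<theta>\<^sub>X * \<theta>\<^sub>Y) powr a\<^sub>X / (a\<^sub>Y - a\<^sub>X)
                + z powr (- a\<^sub>Y - 1) * (\<theta>\<^sub>X * \<theta>\<^sub>Y) powr a\<^sub>Y / (a\<^sub>X - a\<^sub>Y))
             else 0))
       \<and> (\<forall>a. a\<^sub>X = a \<and> a\<^sub>Y = a \<longrightarrow>
           has_pdf M Z (\<lambda>z. if z > \<theta>\<^sub>X * \<theta>\<^sub>Y
             then a\<^sup>2 * (\<theta>\<^sub>X * \<theta>\<^sub>Y) powr a * z powr (- a - 1) * ln (z / (\<theta>\<^sub>X * \<theta>\<^sub>Y))
             else 0))"
proof (intro conjI impI allI)
  note pareto = has_pdf_mult_paretoI[OF assms(1-8), folded assms(9)]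
  have le: "\<theta>\<^sub>Y \<le> z / \<theta>\<^sub>X" if "\<theta>\<^sub>X * \<theta>\<^sub>Y < z" for z
    using that assms(3) by (simp add: field_simps)
  \<comment> \<open>Splits the difference of the endpoint values and absorbs the minus sign into the
    denominator \<open>v - u\<close>, as in the stated density.\<close>
  have partial_fractions: "k * (p - q) / (u - v) = k * (q / (v - u) + p / (u - v))"
    for k p q u v :: real
  proof -
    have "q / (v - u) = - (q / (u - v))"
      using minus_divide_right[of q "u - v"] by simp
    then show ?thesis
      by (simp add: diff_divide_distrib flip: times_divide_eq_right)
  qed
  {
    assume neq: "a\<^sub>X \<noteq> a\<^sub>Y"
    show "has_pdf M Z (\<lambda>z. if z > \<theta>\<^sub>X * \<theta>\<^sub>Y
             then a\<^sub>X * a\<^sub>Y *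
               (z powr (- a\<^sub>X - 1) * (\<theta>\<^sub>X * \<theta>\<^sub>Y) powr a\<^sub>X / (a\<^sub>Y - a\<^sub>X)
                + z powr (- a\<^sub>Y - 1) * (\<theta>\<^sub>X * \<theta>\<^sub>Y) powr a\<^sub>Y / (a\<^sub>X - a\<^sub>Y))
             else 0)"
    proof (rule pareto)
      fix z assume z: "\<theta>\<^sub>X * \<theta>\<^sub>Y < z"
      then have "0 < z"
        using assms(3,5) by (smt (verit) mult_pos_pos)
      let ?c = "a\<^sub>X * a\<^sub>Y * \<theta>\<^sub>X powr a\<^sub>X * \<theta>\<^sub>Y powr a\<^sub>Y * z powr (- a\<^sub>X - 1)"
      let ?r = "a\<^sub>X - a\<^sub>Y"
      \<comment> \<open>The endpoint \<open>y = z / \<theta>\<^sub>X\<close> yields the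
        \<open>a\<^sub>Y\<close> term: the exponents of \<open>z\<close> add up to
        \<open>- a\<^sub>Y - 1\<close>, those of \<open>\<theta>\<^sub>X\<close> to
        \<open>a\<^sub>X - (a\<^sub>X - a\<^sub>Y) = a\<^sub>Y\<close>.\<close>
      have upper: "\<theta>\<^sub>X powr a\<^sub>X * \<theta>\<^sub>Y powr a\<^sub>Y * z powr (- a\<^sub>X - 1) * (z / \<theta>\<^sub>X) powr ?r =
          z powr (- a\<^sub>Y - 1) * (\<theta>\<^sub>X * \<theta>\<^sub>Y) powr a\<^sub>Y"
      proof -
        have "z powr (- a\<^sub>X - 1) * z powr ?r = z powr (- a\<^sub>Y - 1)"
          by (simp add: algebra_simps flip: powr_add)
        moreover have "\<theta>\<^sub>X powr a\<^sub>X = \<theta>\<^sub>X powr a\<^sub>Y * \<theta>\<^sub>X powr ?r"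
          by (simp flip: powr_add)
        ultimately show ?thesis
          using assms(3,5) \<open>0 < z\<close> by (simp add: powr_divide powr_mult)
      qed
      \<comment> \<open>The endpoint \<open>y = \<theta>\<^sub>Y\<close> yields the
        \<open>a\<^sub>X\<close> term: only the exponent of \<open>\<theta>\<^sub>Y\<close> changes,
        to \<open>a\<^sub>Y + (a\<^sub>X - a\<^sub>Y) = a\<^sub>X\<close>.\<close>
      have lower: "\<theta>\<^sub>X powr a\<^sub>X * \<theta>\<^sub>Y powr a\<^sub>Y * z powr (- a\<^sub>X - 1) * \<theta>\<^sub>Y powr ?r =
          z powr (- a\<^sub>X - 1) * (\<theta>\<^sub>X * \<theta>\<^sub>Y) powr a\<^sub>X"
      proof -
        have "\<theta>\<^sub>Y powr a\<^sub>Y * \<theta>\<^sub>Y powr ?r = \<theta>\<^sub>Y powr a\<^sub>X"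
          by (simp flip: powr_add)
        then show ?thesis
          using assms(3,5) by (simp add: powr_mult)
      qed
      have "?c * ((z / \<theta>\<^sub>X) powr ?r - \<theta>\<^sub>Y powr ?r) / ?r =
          a\<^sub>X * a\<^sub>Y * (z powr (- a\<^sub>Y - 1) * (\<theta>\<^sub>X * \<theta>\<^sub>Y) powr a\<^sub>Y -
            z powr (- a\<^sub>X - 1) * (\<theta>\<^sub>X * \<theta>\<^sub>Y) powr a\<^sub>X) / ?r"
        unfolding upper[symmetric] lower[symmetric] by (simp add: algebra_simps)
      also have "\<dots> = a\<^sub>X * a\<^sub>Y *
          (z powr (- a\<^sub>X - 1) * (\<theta>\<^sub>X * \<theta>\<^sub>Y) powr a\<^sub>X / (a\<^sub>Y - a\<^sub>X)
           + z powr (- a\<^sub>Y - 1) * (\<theta>\<^sub>X * \<theta>\<^sub>Y) powr a\<^sub>Y / (a\<^sub>X - a\<^sub>Y))"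
        by (rule partial_fractions)
      finally show "((\<lambda>y. ?c * y powr (?r - 1)) has_integral a\<^sub>X * a\<^sub>Y *
          (z powr (- a\<^sub>X - 1) * (\<theta>\<^sub>X * \<theta>\<^sub>Y) powr a\<^sub>X / (a\<^sub>Y - a\<^sub>X)
           + z powr (- a\<^sub>Y - 1) * (\<theta>\<^sub>X * \<theta>\<^sub>Y) powr a\<^sub>Y / (a\<^sub>X - a\<^sub>Y))) {\<theta>\<^sub>Y..z / \<theta>\<^sub>X}"
        using has_integral_powr_diff_neq[of ?r \<theta>\<^sub>Y "z / \<theta>\<^sub>X" ?c] neq assms(5) le[OF z] by simp
    qed measurable
  next
    fix a assume a: "a\<^sub>X = a \<and> a\<^sub>Y = a"
    show "has_pdf M Z (\<lambda>z. if z > \<theta>\<^sub>X * \<theta>\<^sub>Y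
             then a\<^sup>2 * (\<theta>\<^sub>X * \<theta>\<^sub>Y) powr a * z powr (- a - 1) * ln (z / (\<theta>\<^sub>X * \<theta>\<^sub>Y))
             else 0)"
    proof (rule pareto)
      fix z assume z: "\<theta>\<^sub>X * \<theta>\<^sub>Y < z"
      then show "((\<lambda>y. a\<^sub>X * a\<^sub>Y * \<theta>\<^sub>X powr a\<^sub>X * \<theta>\<^sub>Y powr a\<^sub>Y * z powr (- a\<^sub>X - 1) *
            y powr (a\<^sub>X - a\<^sub>Y - 1)) has_integral
          a\<^sup>2 * (\<theta>\<^sub>X * \<theta>\<^sub>Y) powr a * z powr (- a - 1) * ln (z / (\<theta>\<^sub>X * \<theta>\<^sub>Y))) {\<theta>\<^sub>Y..z / \<theta>\<^sub>X}"
        \<comment> \<open>For equal parameters the exponent of \<open>y\<close> is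
          \<open>- 1\<close>, and the quotient of the endpoints \<open>z / \<theta>\<^sub>X\<close>
          and \<open>\<theta>\<^sub>Y\<close> is the argument of the logarithm.\<close>
        using has_integral_powr_minus_one[of \<theta>\<^sub>Y "z / \<theta>\<^sub>X"
            "a\<^sup>2 * (\<theta>\<^sub>X * \<theta>\<^sub>Y) powr a * z powr (- a - 1)"] le[OF z] a assms(3,5)
        by (simp add: powr_mult power2_eq_square mult.assoc)
    qed measurable
  }
qed

end
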